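(* Let $\mathcal{H}$ (support states) and $\mathcal{A}$ (actions) be finite sets, $P$ a probability distribution on $\mathcal{H}$, and $Z$ a fixed consequence geometry with utilities $U(a\mid H,Z)$ and regret distortion $d_Z(H,a)=U(\pi^*(H,Z)\mid H,Z)-U(a\mid H,Z)$. Consider the rate-regret problem $$R_Z(\varepsilon)=\min_{p(\hat a\mid H)} I(H;\hat A)\quad\text{subject to}\quad \mathbb{E}[d_Z(H,\hat A)]\le\varepsilon .$$ The Lagrange-optimal stochastic action channel for this problem has the form $$p_\beta(\hat a\mid H)=\frac{p_\beta(\hat a)\exp[-\beta d_Z(H,\hat a)]}{\sum_{a'\in\mathcal{A}}p_\beta(a')\exp[-\beta d_Z(H,a')]},$$ where $\beta\ge 0$ is the Lagrange multiplier controlling the regret-information tradeoff, and $$p_\beta(\hat a)=\sum_{H}P(H)\,p_\beta(\hat a\mid H)$$ is determined self-consistently.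
   Context: For each $H\in\mathcal{H}$, $U(a\mid H,Z)$ is the expected utility of action $a$ given $H$ and $Z$, and $\pi^*(H,Z)$ is the element of $\arg\max_{a\in\mathcal{A}}U(a\mid H,Z)$ selected by a fixed tie-breaking rule. A stochastic action channel is a family of probability distributions $p(\cdot\mid H)$ on $\mathcal{A}$, one for each $H\in\mathcal{H}$. The action recommendation $\hat A$ takes values in $\mathcal{A}$, and $(H,\hat A)$ has joint law $P(H)p(\hat a\mid H)$; $I(H;\hat A)$ is the mutual information and $\mathbb{E}[d_Z(H,\hat A)]$ the expected regret under this joint law. Lagrange-optimal refers to minimizing the unconstrained objective $\mathcal{L}=I(H;\hat A)+\beta\,\mathbb{E}[d_Z(H,\hat A)]$ over channels, with normalization imposed for each conditional distribution $p(\hat a\mid H)$.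
   Formalization: Optimality does not constrain the channel at states H with P(H)=0, so every Lagrange-optimal channel is shown to have the stated form at each H with P(H)>0, and some Lagrange-optimal channel is shown to have it at every H. *)

theory Defs
  imports "HOL-Probability.Probability"
begin

text \<open>
  \<open>U a H Z\<close> is the expected utility of the action \<open>a\<close> given the support state \<open>H\<close> and the
  consequence geometry \<open>Z\<close>. Nothing is assumed about the type of consequence geometries.
\<close>

definition best_actions :: "('a \<Rightarrow> 'h \<Rightarrow> 'z \<Rightarrow> real) \<Rightarrow> 'h \<Rightarrow> 'z \<Rightarrow> 'a set" where
  "best_actions U H Z = {a. is_arg_max (\<lambda>a. U a H Z) (\<lambda>_. True) a}"

definition regret ::
  "('a \<Rightarrow> 'h \<Rightarrow> 'z \<Rightarrow> real) \<Rightarrow> ('h \<Rightarrow> 'z \<Rightarrow> 'a) \<Rightarrow> 'z \<Rightarrow> 'h \<Rightarrow> 'a \<Rightarrow> real" where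
  "regret U \<pi> Z H a = U (\<pi> H Z) H Z - U a H Z"

text \<open>
  A stochastic action channel is a function of type \<open>'h \<Rightarrow> 'a pmf\<close>, so that each conditional
  distribution is normalised by its type.
\<close>

definition joint_law :: "'h pmf \<Rightarrow> ('h \<Rightarrow> 'a pmf) \<Rightarrow> ('h \<times> 'a) pmf" where
  "joint_law P p = bind_pmf P (\<lambda>H. map_pmf (\<lambda>a. (H, a)) (p H))"

text \<open>
  Information is measured in nats: a multiplier \<open>\<beta>\<close> matches the weights
  \<open>exp (- \<beta> * d H a)\<close> only for the natural logarithm.
\<close>

definition channel_information :: "'h pmf \<Rightarrow> ('h \<Rightarrow> 'a pmf) \<Rightarrow> real" where
  "channel_information P p =
     prob_space.mutual_information (measure_pmf (joint_law P p)) (exp 1)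
       (count_space UNIV) (count_space UNIV) fst snd"

definition expected_regret ::
  "'h pmf \<Rightarrow> ('h \<Rightarrow> 'a \<Rightarrow> real) \<Rightarrow> ('h \<Rightarrow> 'a pmf) \<Rightarrow> real" where
  "expected_regret P d p = measure_pmf.expectation (joint_law P p) (\<lambda>(H, a). d H a)"

definition rate_regret :: "'h pmf \<Rightarrow> ('h \<Rightarrow> 'a \<Rightarrow> real) \<Rightarrow> real \<Rightarrow> real" where
  "rate_regret P d \<epsilon> = (INF p\<in>{p. expected_regret P d p \<le> \<epsilon>}. channel_information P p)"

definition lagrangian ::
  "'h pmf \<Rightarrow> ('h \<Rightarrow> 'a \<Rightarrow> real) \<Rightarrow> real \<Rightarrow> ('h \<Rightarrow> 'a pmf) \<Rightarrow> real" where
  "lagrangian P d \<beta> p = channel_information P p + \<beta> * expected_regret P d p"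

text \<open>
  Channels that differ only at states of probability zero have the same Lagrangian, so optimality
  does not restrict a channel at those states.
\<close>

definition lagrange_optimal ::
  "'h pmf \<Rightarrow> ('h \<Rightarrow> 'a \<Rightarrow> real) \<Rightarrow> real \<Rightarrow> ('h \<Rightarrow> 'a pmf) \<Rightarrow> bool" where
  "lagrange_optimal P d \<beta> p \<longleftrightarrow> is_arg_min (lagrangian P d \<beta>) (\<lambda>_. True) p"

definition action_marginal :: "'h::finite pmf \<Rightarrow> ('h \<Rightarrow> 'a pmf) \<Rightarrow> 'a \<Rightarrow> real" where
  "action_marginal P p a = (\<Sum>H\<in>UNIV. pmf P H * pmf (p H) a)"

text \<open>
  The weights \<open>action_marginal P p\<close> belong to \<open>p\<close> itself, so this is a fixed-point equation.
\<close>

definition gibbs_form ::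
  "'h::finite pmf \<Rightarrow> ('h \<Rightarrow> 'a::finite \<Rightarrow> real) \<Rightarrow> real \<Rightarrow> ('h \<Rightarrow> 'a pmf) \<Rightarrow> 'h \<Rightarrow> bool" where
  "gibbs_form P d \<beta> p H \<longleftrightarrow>
     (\<forall>a. pmf (p H) a =
        action_marginal P p a * exp (- \<beta> * d H a) /
        (\<Sum>a'\<in>UNIV. action_marginal P p a' * exp (- \<beta> * d H a')))"

end

theory Submission
  imports Defs
begin

text \<open>
  For an action law \<open>q\<close> put \<open>G q = - (\<Sum>H. P H * ln (\<Sum>a. q a * exp (- \<beta> * d H a)))\<close> and let
  \<open>t q\<close> be the channel that reweights \<open>q\<close> by \<open>exp (- \<beta> * d H a)\<close>. Whenever \<open>q\<close> dominates the
  channel \<open>p\<close>, whose action law is \<open>m p\<close>, the Lagrangian of \<open>p\<close> equals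
  \<open>G q + (\<Sum>H. P H * KL (p H) (t q H)) - KL (m p) q\<close>. With \<open>q = m p\<close> this bounds the Lagrangian
  of \<open>p\<close> below by \<open>G (m p)\<close>, and with \<open>p = t q\<close> it bounds that of \<open>t q\<close> above by \<open>G q\<close>. Hence
  an optimal \<open>p\<close> satisfies \<open>KL (p H) (t (m p) H) = 0\<close> at every state of positive probability,
  which is the Gibbs form; and a minimiser of the continuous \<open>G\<close> on the simplex gives an optimal
  channel.
\<close>

section \<open>Relative entropy on a finite type\<close>

text \<open>Kullback-Leibler divergence in nats. Where \<open>q\<close> vanishes and
  \<open>r\<close> does not, division by zero yields a finite default term instead of infinity;
  hence the support inclusions assumed below.\<close>

definition relative_entropy :: "'a::finite pmf \<Rightarrow> 'a pmf \<Rightarrow> real" where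
  "relative_entropy r q = (\<Sum>a\<in>UNIV. pmf r a * ln (pmf r a / pmf q a))"

lemma relative_entropy_self [simp]: "relative_entropy q q = 0"
  unfolding relative_entropy_def by (rule sum.neutral) auto

text \<open>The inequality ln t \<le> t - 1 at t = y / x, multiplied by x.\<close>

lemma mult_ln_divide_ge:
  fixes x y :: real
  assumes "x \<ge> 0" "y \<ge> 0" "y = 0 \<Longrightarrow> x = 0"
  shows "x - y \<le> x * ln (x / y)"
proof (cases "x = 0")
  case False
  then have pos: "x > 0" "y > 0" using assms by force+
  have "x * ln (y / x) \<le> x * (y / x - 1)"
    using pos by (intro mult_left_mono ln_le_minus_one) auto
  also have "\<dots> = y - x" using pos by (simp add: field_simps)
  finally show ?thesis using pos by (simp add: ln_div algebra_simps)
qed (use assms in auto)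

text \<open>Equality in ln t \<le> t - 1 occurs only at t = 1.\<close>

lemma mult_ln_divide_eq_imp_eq:
  fixes x y :: real
  assumes "x \<ge> 0" "y \<ge> 0" "y = 0 \<Longrightarrow> x = 0" "x * ln (x / y) = x - y"
  shows "x = y"
proof (cases "x = 0")
  case False
  then have pos: "x > 0" "y > 0" using assms by force+
  have "x * ln (y / x) = y - x"
    using pos assms(4) by (simp add: ln_div algebra_simps)
  also have "y - x = x * (y / x - 1)" using pos by (simp add: right_diff_distrib)
  finally have "ln (y / x) = y / x - 1" using pos by simp
  then have "y / x = 1" using pos by (intro ln_eq_minus_one) auto
  then show ?thesis using pos by simp
qed (use assms in auto)

lemma sum_pmf_UNIV: "(\<Sum>a\<in>UNIV. pmf (q :: 'a::finite pmf) a) = 1"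
  by (rule sum_pmf_eq_1) auto

lemma relative_entropy_nonneg:
  assumes "set_pmf r \<subseteq> set_pmf q"
  shows "relative_entropy r q \<ge> 0"
proof -
  \<comment> \<open>The left side is 1 - 1 = 0.\<close>
  have "(\<Sum>a\<in>UNIV. pmf r a - pmf q a) \<le> relative_entropy r q"
    unfolding relative_entropy_def using assms
    by (intro sum_mono mult_ln_divide_ge) (auto simp: set_pmf_eq)
  then show ?thesis by (simp add: sum_subtractf sum_pmf_UNIV)
qed

text \<open>The pointwise gaps \<open>?g\<close> are nonnegative and sum to 0, so each one
  vanishes.\<close>

lemma relative_entropy_eq_0_imp_eq:
  assumes "set_pmf r \<subseteq> set_pmf q" "relative_entropy r q = 0"
  shows "r = q"
proof (rule pmf_eqI)
  fix a
  let ?g = "\<lambda>a. pmf r a * ln (pmf r a / pmf q a) - (pmf r a - pmf q a)"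
  have "?g a \<ge> 0" for a
    using mult_ln_divide_ge[of "pmf r a" "pmf q a"] assms(1) by (auto simp: set_pmf_eq)
  moreover have "(\<Sum>a\<in>UNIV. ?g a) = 0"
    using assms(2) by (simp add: relative_entropy_def sum_subtractf sum_pmf_UNIV)
  ultimately have "?g a = 0"
    by (subst (asm) sum_nonneg_eq_0_iff) auto
  then show "pmf r a = pmf q a"
    using mult_ln_divide_eq_imp_eq[of "pmf r a" "pmf q a"] assms(1) by (auto simp: set_pmf_eq)
qed

section \<open>Reweighted distributions\<close>

definition partition_sum :: "'a::finite pmf \<Rightarrow> ('a \<Rightarrow> real) \<Rightarrow> real" where
  "partition_sum q w = (\<Sum>a\<in>UNIV. pmf q a * w a)"

text \<open>Exponential tilting of \<open>q\<close> when \<open>w\<close> is an exponential.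
  Positive weights make the normaliser positive, so that \<open>embed_pmf\<close> receives a genuine
  mass function.\<close>

definition reweight_pmf :: "'a::finite pmf \<Rightarrow> ('a \<Rightarrow> real) \<Rightarrow> 'a pmf" where
  "reweight_pmf q w = embed_pmf (\<lambda>a. pmf q a * w a / partition_sum q w)"

lemma partition_sum_pos:
  assumes "\<And>a. w a > 0"
  shows "partition_sum q w > 0"
proof -
  obtain a where "a \<in> set_pmf q" using set_pmf_not_empty[of q] by blast
  then have "pmf q a * w a > 0" using assms by (simp add: pmf_positive)
  then show ?thesis
    unfolding partition_sum_def using assms
    by (intro sum_pos2[where i = a]) (auto simp: less_imp_le)
qed

lemma pmf_reweight_pmf:
  assumes "\<And>a. w a > 0"
  shows "pmf (reweight_pmf q w) a = pmf q a * w a / partition_sum q w"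
proof -
  have pos: "partition_sum q w > 0" using assms by (rule partition_sum_pos)
  have nonneg: "0 \<le> pmf q a * w a / partition_sum q w" for a
    using pos assms[of a] by simp
  have "(\<Sum>a\<in>UNIV. pmf q a * w a / partition_sum q w) = 1"
    using pos by (simp add: partition_sum_def flip: sum_divide_distrib)
  then show ?thesis
    unfolding reweight_pmf_def using nonneg
    by (subst pmf_embed_pmf) (auto simp: nn_integral_count_space_finite)
qed

lemma set_reweight_pmf:
  assumes "\<And>a. w a > 0"
  shows "set_pmf (reweight_pmf q w) = set_pmf q"
proof -
  have "w a \<noteq> 0" for a using assms[of a] by simp
  moreover have "partition_sum q w \<noteq> 0" using partition_sum_pos[of w q] assms by simp
  ultimately show ?thesis by (simp add: set_pmf_eq pmf_reweight_pmf[OF assms])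
qed

section \<open>The Lagrangian as a finite sum\<close>

lemma pmf_joint_law: "pmf (joint_law P p) (H, a) = pmf P H * pmf (p H) a"
proof -
  have "pmf (map_pmf (\<lambda>a. (H', a)) (p H')) (H, a) = indicator {H} H' * pmf (p H) a" for H'
  proof (cases "H' = H")
    case True
    then show ?thesis using pmf_map_inj'[of "Pair H" "p H" a] by (simp add: inj_on_def)
  qed (auto simp: pmf_eq_0_set_pmf)
  then show ?thesis by (simp add: joint_law_def pmf_bind measure_pmf_single)
qed

lemma map_fst_joint_law: "map_pmf fst (joint_law P p) = P"
  by (simp add: joint_law_def map_bind_pmf pmf.map_comp o_def map_pmf_const bind_return_pmf')

lemma map_snd_joint_law: "map_pmf snd (joint_law P p) = bind_pmf P p"
  by (simp add: joint_law_def map_bind_pmf pmf.map_comp o_def)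

lemma action_marginal_eq_pmf: "action_marginal P p a = pmf (bind_pmf P p) a"
  by (simp add: action_marginal_def pmf_bind integral_measure_pmf_real[of UNIV] mult.commute)

text \<open>Supplies the premises of the finite-sum formula for mutual information.\<close>

lemma simple_distributed_measure_pmf:
  assumes "finite (range f)"
  shows "simple_distributed (measure_pmf M) f (pmf (map_pmf f M))"
proof (rule measure_pmf.simple_distributedI)
  show "simple_function (measure_pmf M) f"
    using assms by (simp add: simple_function_def)
  show "pmf (map_pmf f M) x = measure_pmf.prob M (f -` {x} \<inter> space (measure_pmf M))" for x
    by (simp add: pmf_map)
qed simp

lemma channel_information_eq_sum:
  fixes P :: "'h::finite pmf" and p :: "'h \<Rightarrow> 'a::finite pmf"
  shows "channel_information P p =
    (\<Sum>H\<in>UNIV. pmf P H * relative_entropy (p H) (bind_pmf P p))"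
proof -
  let ?J = "joint_law P p"
  interpret information_space "measure_pmf ?J" "exp 1"
    by unfold_locales auto
  have "channel_information P p = (\<Sum>(H, a)\<in>UNIV. pmf ?J (H, a) *
      log (exp 1) (pmf ?J (H, a) / (pmf P H * pmf (bind_pmf P p) a)))"
    using mutual_information_simple_distributed[
        OF simple_distributed_measure_pmf[of fst ?J] simple_distributed_measure_pmf[of snd ?J]
          simple_distributed_measure_pmf[of "\<lambda>x. (fst x, snd x)" ?J]]
    by (simp add: channel_information_def map_fst_joint_law map_snd_joint_law pmf.map_id)
  also have "\<dots> = (\<Sum>H\<in>UNIV. \<Sum>a\<in>UNIV.
      pmf P H * (pmf (p H) a * ln (pmf (p H) a / pmf (bind_pmf P p) a)))"
    \<comment> \<open>The factor \<open>pmf P H\<close> cancels inside the logarithm; where it is 0,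
      both sides vanish.\<close>
    unfolding UNIV_Times_UNIV[symmetric] sum.cartesian_product[symmetric]
    by (intro sum.cong refl) (simp add: pmf_joint_law log_def)
  finally show ?thesis by (simp add: relative_entropy_def sum_distrib_left)
qed

lemma expected_regret_eq_sum:
  fixes P :: "'h::finite pmf" and p :: "'h \<Rightarrow> 'a::finite pmf"
  shows "expected_regret P d p = (\<Sum>H\<in>UNIV. pmf P H * (\<Sum>a\<in>UNIV. pmf (p H) a * d H a))"
proof -
  have "expected_regret P d p = (\<Sum>(H, a)\<in>UNIV. d H a * pmf (joint_law P p) (H, a))"
    unfolding expected_regret_def
    by (subst integral_measure_pmf_real[of UNIV]) (auto simp: case_prod_unfold)
  also have "\<dots> = (\<Sum>H\<in>UNIV. \<Sum>a\<in>UNIV. pmf P H * (pmf (p H) a * d H a))"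
    unfolding UNIV_Times_UNIV[symmetric] sum.cartesian_product[symmetric]
    by (intro sum.cong refl) (simp add: pmf_joint_law)
  finally show ?thesis by (simp add: sum_distrib_left)
qed

section \<open>Gibbs channels and the free-energy identity\<close>

definition free_energy ::
  "'h::finite pmf \<Rightarrow> ('h \<Rightarrow> 'a::finite \<Rightarrow> real) \<Rightarrow> real \<Rightarrow> 'a pmf \<Rightarrow> real" where
  "free_energy P d \<beta> q =
     - (\<Sum>H\<in>UNIV. pmf P H * ln (partition_sum q (\<lambda>a. exp (- \<beta> * d H a))))"

text \<open>This is the map \<open>t\<close> of the opening outline, and \<open>free_energy\<close>
  is its \<open>G\<close>.\<close>

definition gibbs_channel ::
  "('h \<Rightarrow> 'a::finite \<Rightarrow> real) \<Rightarrow> real \<Rightarrow> 'a pmf \<Rightarrow> 'h \<Rightarrow> 'a pmf" where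
  "gibbs_channel d \<beta> q H = reweight_pmf q (\<lambda>a. exp (- \<beta> * d H a))"

lemma set_gibbs_channel: "set_pmf (gibbs_channel d \<beta> q H) = set_pmf q"
  by (simp add: gibbs_channel_def set_reweight_pmf)

lemma gibbs_form_iff:
  "gibbs_form P d \<beta> p H \<longleftrightarrow> p H = gibbs_channel d \<beta> (bind_pmf P p) H"
  by (simp add: gibbs_form_def gibbs_channel_def pmf_eq_iff pmf_reweight_pmf partition_sum_def
      action_marginal_eq_pmf)

text \<open>Where \<open>r\<close> has mass, all the ratios are positive and the logarithms split
  termwise; the constant \<open>ln ?Z\<close> survives averaging because \<open>r\<close> has total
  mass 1. For w = exp (-\<beta> d) the sum subtracted on the left is -\<beta> times the mean regret
  under \<open>r\<close>.\<close>

lemma relative_entropy_reweight: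
  assumes "set_pmf r \<subseteq> set_pmf q" "set_pmf r \<subseteq> set_pmf m" and w: "\<And>a. w a > 0"
  shows "relative_entropy r m - (\<Sum>a\<in>UNIV. pmf r a * ln (w a)) =
    - ln (partition_sum q w) + relative_entropy r (reweight_pmf q w)
    - (\<Sum>a\<in>UNIV. pmf r a * ln (pmf m a / pmf q a))"
proof -
  let ?Z = "partition_sum q w"
  have Z: "?Z > 0" using w by (rule partition_sum_pos)
  have "pmf r a * ln (pmf r a / pmf m a) - pmf r a * ln (w a) =
      - (pmf r a * ln ?Z) + pmf r a * ln (pmf r a / pmf (reweight_pmf q w) a)
      - pmf r a * ln (pmf m a / pmf q a)" for a
  proof (cases "pmf r a = 0")
    case False
    then have "pmf r a > 0" "pmf q a > 0" "pmf m a > 0"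
      using assms by (auto simp: set_pmf_eq pmf_pos)
    then show ?thesis
      using Z w[of a] by (simp add: pmf_reweight_pmf[OF w] ln_div ln_mult algebra_simps)
  qed simp
  then have "(\<Sum>a\<in>UNIV. pmf r a * ln (pmf r a / pmf m a) - pmf r a * ln (w a)) =
      (\<Sum>a\<in>UNIV. - (pmf r a * ln ?Z) + pmf r a * ln (pmf r a / pmf (reweight_pmf q w) a)
      - pmf r a * ln (pmf m a / pmf q a))"
    by presburger
  moreover have "(\<Sum>a\<in>UNIV. pmf r a * ln ?Z) = ln ?Z"
    by (simp add: sum_pmf_UNIV flip: sum_distrib_right)
  ultimately show ?thesis
    by (simp add: relative_entropy_def sum_subtractf sum.distrib sum_negf)
qed

text \<open>Averages the tilting identity over the states. States of probability zero carry weight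
  0, so domination matters only on the support of \<open>P\<close>.\<close>

lemma lagrangian_eq_free_energy:
  fixes P :: "'h::finite pmf" and p :: "'h \<Rightarrow> 'a::finite pmf"
  assumes dom: "\<And>H. H \<in> set_pmf P \<Longrightarrow> set_pmf (p H) \<subseteq> set_pmf q"
  shows "lagrangian P d \<beta> p = free_energy P d \<beta> q
    + (\<Sum>H\<in>UNIV. pmf P H * relative_entropy (p H) (gibbs_channel d \<beta> q H))
    - relative_entropy (bind_pmf P p) q"
proof -
  let ?m = "bind_pmf P p"
  let ?c = "\<lambda>H. \<Sum>a\<in>UNIV. pmf (p H) a * ln (pmf ?m a / pmf q a)"
  have "pmf P H * relative_entropy (p H) ?m + \<beta> * (pmf P H * (\<Sum>a\<in>UNIV. pmf (p H) a * d H a)) =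
      - (pmf P H * ln (partition_sum q (\<lambda>a. exp (- \<beta> * d H a))))
      + pmf P H * relative_entropy (p H) (gibbs_channel d \<beta> q H) - pmf P H * ?c H" for H
  proof (cases "H \<in> set_pmf P")
    case True
    then have "set_pmf (p H) \<subseteq> set_pmf ?m" by auto
    from relative_entropy_reweight[OF dom[OF True] this, of "\<lambda>a. exp (- \<beta> * d H a)"]
    have "relative_entropy (p H) ?m + \<beta> * (\<Sum>a\<in>UNIV. pmf (p H) a * d H a) =
      - ln (partition_sum q (\<lambda>a. exp (- \<beta> * d H a)))
      + relative_entropy (p H) (gibbs_channel d \<beta> q H) - ?c H"
      by (simp add: gibbs_channel_def sum_negf sum_distrib_left mult.left_commute)
    from arg_cong[OF this, of "\<lambda>x. pmf P H * x"] show ?thesis by (simp add: algebra_simps)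
  qed (simp add: set_pmf_eq)
  then have "lagrangian P d \<beta> p = (\<Sum>H\<in>UNIV.
      - (pmf P H * ln (partition_sum q (\<lambda>a. exp (- \<beta> * d H a))))
      + pmf P H * relative_entropy (p H) (gibbs_channel d \<beta> q H) - pmf P H * ?c H)"
    by (simp add: lagrangian_def channel_information_eq_sum expected_regret_eq_sum
        sum_distrib_left[of \<beta>] flip: sum.distrib)
  \<comment> \<open>The logarithm in \<open>?c\<close> does not depend on \<open>H\<close>, so
    averaging over states first turns \<open>p H\<close> into the marginal.\<close>
  moreover have "(\<Sum>H\<in>UNIV. pmf P H * ?c H) = relative_entropy ?m q"
  proof -
    have "(\<Sum>H\<in>UNIV. pmf P H * ?c H) =
        (\<Sum>a\<in>UNIV. \<Sum>H\<in>UNIV. pmf P H * pmf (p H) a * ln (pmf ?m a / pmf q a))"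
      unfolding sum_distrib_left mult.assoc by (rule sum.swap)
    also have "\<dots> = (\<Sum>a\<in>UNIV. action_marginal P p a * ln (pmf ?m a / pmf q a))"
      by (simp add: action_marginal_def sum_distrib_right)
    finally show ?thesis by (simp add: relative_entropy_def action_marginal_eq_pmf)
  qed
  ultimately show ?thesis
    by (simp add: free_energy_def sum_subtractf sum.distrib sum_negf)
qed

lemma lagrangian_marginal:
  fixes P :: "'h::finite pmf" and p :: "'h \<Rightarrow> 'a::finite pmf"
  shows "lagrangian P d \<beta> p = free_energy P d \<beta> (bind_pmf P p)
    + (\<Sum>H\<in>UNIV. pmf P H * relative_entropy (p H) (gibbs_channel d \<beta> (bind_pmf P p) H))"
  by (subst lagrangian_eq_free_energy[where q = "bind_pmf P p"]) auto

text \<open>On the support of \<open>P\<close> the marginal dominates \<open>p H\<close>; elsewhere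
  it need not, but the weight is 0.\<close>

lemma weighted_relative_entropy_gibbs_nonneg:
  fixes P :: "'h::finite pmf" and p :: "'h \<Rightarrow> 'a::finite pmf"
  shows "pmf P H * relative_entropy (p H) (gibbs_channel d \<beta> (bind_pmf P p) H) \<ge> 0"
proof (cases "H \<in> set_pmf P")
  case True
  then show ?thesis
    by (intro mult_nonneg_nonneg relative_entropy_nonneg) (auto simp: set_gibbs_channel)
qed (simp add: set_pmf_eq)

lemma free_energy_le_lagrangian:
  fixes P :: "'h::finite pmf" and p :: "'h \<Rightarrow> 'a::finite pmf"
  shows "free_energy P d \<beta> (bind_pmf P p) \<le> lagrangian P d \<beta> p"
  by (simp add: lagrangian_marginal sum_nonneg weighted_relative_entropy_gibbs_nonneg)

lemma lagrangian_gibbs_channel_le: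
  fixes P :: "'h::finite pmf" and q :: "'a::finite pmf"
  shows "lagrangian P d \<beta> (gibbs_channel d \<beta> q) \<le> free_energy P d \<beta> q"
proof -
  have "relative_entropy (bind_pmf P (gibbs_channel d \<beta> q)) q \<ge> 0"
    by (intro relative_entropy_nonneg) (auto simp: set_gibbs_channel)
  then show ?thesis
    by (subst lagrangian_eq_free_energy[where q = q]) (auto simp: set_gibbs_channel)
qed

section \<open>Existence and form of the optimal channels\<close>

lemma lagrange_optimal_iff:
  "lagrange_optimal P d \<beta> p \<longleftrightarrow> (\<forall>p'. lagrangian P d \<beta> p \<le> lagrangian P d \<beta> p')"
  by (auto simp: lagrange_optimal_def is_arg_min_linorder)

lemma lagrange_optimal_imp_gibbs_form:
  fixes P :: "'h::finite pmf" and p :: "'h \<Rightarrow> 'a::finite pmf"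
  assumes opt: "lagrange_optimal P d \<beta> p" and H: "H \<in> set_pmf P"
  shows "gibbs_form P d \<beta> p H"
proof -
  let ?m = "bind_pmf P p"
  \<comment> \<open>The competitor is the Gibbs channel built from the marginal of \<open>p\<close>
    itself.\<close>
  have "lagrangian P d \<beta> p \<le> free_energy P d \<beta> ?m"
    using opt lagrangian_gibbs_channel_le[of P d \<beta> ?m]
    by (meson lagrange_optimal_iff order_trans)
  then have "(\<Sum>H\<in>UNIV. pmf P H * relative_entropy (p H) (gibbs_channel d \<beta> ?m H)) = 0"
    using free_energy_le_lagrangian[of P d \<beta> p] by (simp add: lagrangian_marginal)
  then have "pmf P H * relative_entropy (p H) (gibbs_channel d \<beta> ?m H) = 0"
    by (subst (asm) sum_nonneg_eq_0_iff) (auto simp: weighted_relative_entropy_gibbs_nonneg)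
  then have "relative_entropy (p H) (gibbs_channel d \<beta> ?m H) = 0"
    using H by (simp add: set_pmf_eq)
  then show ?thesis
    unfolding gibbs_form_iff using H
    by (intro relative_entropy_eq_0_imp_eq) (auto simp: set_gibbs_channel)
qed

lemma free_energy_attains_min:
  fixes P :: "'h::finite pmf" and d :: "'h \<Rightarrow> 'a::finite \<Rightarrow> real"
  shows "\<exists>q. \<forall>q'. free_energy P d \<beta> q \<le> free_energy P d \<beta> q'"
proof -
  \<comment> \<open>Mass functions are identified with the probability simplex in a Euclidean space,
    where compactness is available.\<close>
  define S :: "(real ^ 'a) set" where "S = {x. (\<forall>a. 0 \<le> x $ a) \<and> (\<Sum>a\<in>UNIV. x $ a) = 1}"
  define V :: "'a pmf \<Rightarrow> real ^ 'a" where "V q = (\<chi> a. pmf q a)" for q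
  define F :: "real ^ 'a \<Rightarrow> real" where
    "F x = - (\<Sum>H\<in>UNIV. pmf P H * ln (\<Sum>a\<in>UNIV. x $ a * exp (- \<beta> * d H a)))" for x
  have F_V: "F (V q) = free_energy P d \<beta> q" for q
    by (simp add: F_def V_def free_energy_def partition_sum_def)
  have "range V = S"
  proof (intro equalityI subsetI)
    fix x assume x: "x \<in> S"
    have "pmf (embed_pmf (\<lambda>a. x $ a)) a = x $ a" for a
      using x by (subst pmf_embed_pmf) (auto simp: S_def nn_integral_count_space_finite)
    then have "V (embed_pmf (\<lambda>a. x $ a)) = x" by (simp add: V_def vec_eq_iff)
    then show "x \<in> range V" by (metis rangeI)
  qed (auto simp: S_def V_def sum_pmf_UNIV)
  have "closed S"
  proof -
    have "S = (\<Inter>a. {x. 0 \<le> x $ a}) \<inter> {x. (\<Sum>a\<in>UNIV. x $ a) = 1}"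
      by (auto simp: S_def)
    moreover have "closed {x :: real ^ 'a. 0 \<le> x $ a}" for a
      by (intro closed_Collect_le continuous_intros)
    moreover have "closed {x :: real ^ 'a. (\<Sum>a\<in>UNIV. x $ a) = 1}"
      by (intro closed_Collect_eq continuous_intros)
    ultimately show ?thesis by (simp add: closed_INT closed_Int)
  qed
  moreover have "bounded S"
  proof (rule boundedI)
    fix x assume "x \<in> S"
    then show "norm x \<le> 1" using norm_le_l1_cart[of x] by (simp add: S_def)
  qed
  ultimately have "compact S" by (simp add: compact_eq_bounded_closed)
  moreover have "continuous_on S F"
  proof -
    \<comment> \<open>Keeps \<open>ln\<close> away from its singularity, so \<open>F\<close> is
      continuous up to the boundary of the simplex.\<close>
    have "(\<Sum>a\<in>UNIV. x $ a * exp (- \<beta> * d H a)) \<noteq> 0" if x: "x \<in> S" for x H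
    proof -
      from x obtain q where "x = V q" unfolding \<open>range V = S\<close>[symmetric] by (rule imageE)
      then show ?thesis
        using partition_sum_pos[of "\<lambda>a. exp (- \<beta> * d H a)" q]
        by (simp add: partition_sum_def V_def)
    qed
    then show ?thesis unfolding F_def by (intro continuous_intros) auto
  qed
  moreover have "S \<noteq> {}" unfolding \<open>range V = S\<close>[symmetric] by simp
  ultimately have "\<exists>x\<in>range V. \<forall>y\<in>range V. F x \<le> F y"
    unfolding \<open>range V = S\<close> by (intro continuous_attains_inf)
  then show ?thesis by (simp add: F_V)
qed

lemma ex_lagrange_optimal_gibbs_form:
  fixes P :: "'h::finite pmf" and d :: "'h \<Rightarrow> 'a::finite \<Rightarrow> real"
  shows "\<exists>p. lagrange_optimal P d \<beta> p \<and> (\<forall>H. gibbs_form P d \<beta> p H)"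
proof -
  obtain q where q: "\<And>q'. free_energy P d \<beta> q \<le> free_energy P d \<beta> q'"
    using free_energy_attains_min[of P d \<beta>] by blast
  define p where "p = gibbs_channel d \<beta> q"
  have p: "lagrange_optimal P d \<beta> p"
    unfolding lagrange_optimal_iff
  proof
    fix p'
    have "lagrangian P d \<beta> p \<le> free_energy P d \<beta> q"
      unfolding p_def by (rule lagrangian_gibbs_channel_le)
    also have "\<dots> \<le> free_energy P d \<beta> (bind_pmf P p')" by (rule q)
    also have "\<dots> \<le> lagrangian P d \<beta> p'" by (rule free_energy_le_lagrangian)
    finally show "lagrangian P d \<beta> p \<le> lagrangian P d \<beta> p'" .
  qed
  \<comment> \<open>\<open>p\<close> need not have the Gibbs form at states of probability zero; \<open>r\<close> corrects it there.\<close>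
  define r where "r = gibbs_channel d \<beta> (bind_pmf P p)"
  have "r H = p H" if "H \<in> set_pmf P" for H
    using lagrange_optimal_imp_gibbs_form[OF p that] by (simp add: gibbs_form_iff r_def)
  \<comment> \<open>Changes at null states leave the marginal alone, so \<open>r\<close> is the
    Gibbs channel of its own marginal.\<close>
  then have "bind_pmf P r = bind_pmf P p" by (intro bind_pmf_cong) auto
  then have "gibbs_form P d \<beta> r H" for H by (simp add: gibbs_form_iff r_def)
  moreover have "lagrange_optimal P d \<beta> r"
  proof -
    have "lagrangian P d \<beta> r \<le> lagrangian P d \<beta> p"
      unfolding r_def
      using lagrangian_gibbs_channel_le free_energy_le_lagrangian by (rule order_trans)
    then show ?thesis using p unfolding lagrange_optimal_iff by (blast intro: order_trans)
  qed
  ultimately show ?thesis by blast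
qed

text \<open>For \<beta> \<ge> 0 a channel with no more regret pays no larger penalty, so optimality
  forces it to carry at least as much information. The infimum is thus attained at
  \<open>p\<close>.\<close>

lemma lagrange_optimal_imp_rate_regret:
  assumes opt: "lagrange_optimal P d \<beta> p" and "\<beta> \<ge> 0"
  shows "channel_information P p = rate_regret P d (expected_regret P d p)"
proof -
  have "channel_information P p \<le> channel_information P p'"
    if "expected_regret P d p' \<le> expected_regret P d p" for p'
  proof -
    have "lagrangian P d \<beta> p \<le> lagrangian P d \<beta> p'"
      using opt by (simp add: lagrange_optimal_iff)
    moreover have "\<beta> * expected_regret P d p' \<le> \<beta> * expected_regret P d p"
      using that \<open>\<beta> \<ge> 0\<close> by (rule mult_left_mono)
    ultimately show ?thesis by (simp add: lagrangian_def)
  qed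
  then show ?thesis
    unfolding rate_regret_def by (intro cInf_eq_minimum[symmetric]) auto
qed

theorem proposition4:
  fixes P :: "'h::finite pmf"
    and U :: "'a::finite \<Rightarrow> 'h \<Rightarrow> 'z \<Rightarrow> real"
    and \<pi> :: "'h \<Rightarrow> 'z \<Rightarrow> 'a"
    and Z :: 'z
    and \<beta> :: real
  assumes "\<And>H. \<pi> H Z \<in> best_actions U H Z"
    and "\<beta> \<ge> 0"
  shows "let d = regret U \<pi> Z in
    (\<exists>p. lagrange_optimal P d \<beta> p \<and> (\<forall>H. gibbs_form P d \<beta> p H)) \<and>
    (\<forall>p. lagrange_optimal P d \<beta> p \<longrightarrow>
       (\<forall>H\<in>set_pmf P. gibbs_form P d \<beta> p H) \<and>
       channel_information P p = rate_regret P d (expected_regret P d p))"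
  unfolding Let_def
  by (intro conjI allI impI ballI ex_lagrange_optimal_gibbs_form lagrange_optimal_imp_gibbs_form
      lagrange_optimal_imp_rate_regret[OF _ assms(2)])

end
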